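(* Let $d\ge 1$ and $K>d$ be integers. Given $\alpha\in\mathbb{Z}_2^K$, there exists a dual frame pair $(\mathcal{F},\mathcal{H})$ for $\mathbb{Z}_2^d$, with $\mathcal{F}=\{f_i\}_{i=1}^K$ and $\mathcal{H}=\{h_i\}_{i=1}^K$, such that $(f_i,h_i)=\alpha[i]$ for every $1\le i\le K$, if and only if $\|\alpha\|_0\equiv d \pmod 2$.
   Context: $\mathbb{Z}_2$ is the field with two elements. The dot product on $\mathbb{Z}_2^d$ is $(a,b)=\sum_{n=1}^d a[n]b[n]\in\mathbb{Z}_2$. A (binary) frame for $\mathbb{Z}_2^d$ is a finite sequence of vectors $\{f_j\}_{j=1}^K$ in $\mathbb{Z}_2^d$ (repetitions and zero vectors allowed) whose span is $\mathbb{Z}_2^d$. A sequence $\mathcal{H}=\{h_j\}_{j=1}^K$ in $\mathbb{Z}_2^d$ is a dual frame of a frame $\mathcal{F}=\{f_j\}_{j=1}^K$ if $y=\sum_{j=1}^K (y,h_j)f_j$ for all $y\in\mathbb{Z}_2^d$; in that case $(\mathcal{F},\mathcal{H})$ is called a dual frame pair. For a binary vector $\alpha$, $\|\alpha\|_0$ is the number of nonzero entries of $\alpha$. *)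

theory Defs
  imports
    "HOL-Library.Z2"
    "HOL-Number_Theory.Cong"
    "Jordan_Normal_Form.VS_Connect"
begin

text \<open>
  The field with two elements is the type \<^typ>\<open>bit\<close>, and the binary vectors of length \<open>d\<close> are
  the elements of \<open>carrier_vec d :: bit vec set\<close>; the dot product is the library's \<open>scalar_prod\<close>.
  A finite sequence \<open>f\<^sub>1, \<dots>, f\<^sub>K\<close> of such vectors is a list of length \<open>K\<close>, so indices are shifted
  from \<open>1, \<dots>, K\<close> to \<open>0, \<dots>, K - 1\<close>, and repetitions and zero vectors are allowed.
\<close>

definition binary_frame :: "nat \<Rightarrow> bit vec list \<Rightarrow> bool" where
  "binary_frame d F \<longleftrightarrow>
     set F \<subseteq> carrier_vec d \<and>
     LinearCombinations.module.span class_ring (module_vec TYPE(bit) d) (set F) = carrier_vec d"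

definition dual_frame_pair :: "nat \<Rightarrow> bit vec list \<Rightarrow> bit vec list \<Rightarrow> bool" where
  "dual_frame_pair d F H \<longleftrightarrow>
     binary_frame d F \<and>
     length H = length F \<and> set H \<subseteq> carrier_vec d \<and>
     (\<forall>y \<in> carrier_vec d.
        y = finsum_vec TYPE(bit) d (\<lambda>j. (y \<bullet> H ! j) \<cdot>\<^sub>v F ! j) {..<length F})"

definition num_nonzero :: "bit vec \<Rightarrow> nat" where
  "num_nonzero v = card {i. i < dim_vec v \<and> v $ i \<noteq> 0}"

end

theory Submission
  imports Defs
begin

text \<open>
  Collect the coordinates of the \<open>f\<^sub>j\<close> and the \<open>h\<^sub>j\<close> as the columns of two \<open>d \<times> K\<close> matrices \<open>F\<close> and \<open>H\<close>.
  Testing the reconstruction formula on unit vectors shows that duality is the matrix equation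
  \<open>F H\<^sup>T = I\<close> (\<open>dual_frame_pair_iff\<close>), while the prescribed numbers are the diagonal of \<open>F\<^sup>T H\<close>.

  Necessity is the identity \<open>tr (F\<^sup>T H) = tr (F H\<^sup>T) = d\<close> (\<open>realizes_trace\<close>), since the entries of
  \<open>\<alpha>\<close> add up to \<open>\<parallel>\<alpha>\<parallel>\<^sub>0\<close> in the field with two elements.

  For sufficiency the pairs may be permuted, so let the \<open>m = \<parallel>\<alpha>\<parallel>\<^sub>0\<close> ones of \<open>\<alpha>\<close> come first.
  If \<open>m \<ge> d\<close>, list the unit vectors and repeat the last one until there are \<open>m\<close> vectors, pad with
  zeros, and pair this sequence with itself (\<open>realizes_many_ones\<close>): the last unit vector
  occurs an odd number of times, so that its repetitions add up to a single one.  If \<open>m < d\<close>, pair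
  \<open>e\<^sub>j\<close> with itself for \<open>j < m\<close>; on the remaining coordinates the diagonal entries must vanish, which
  is achieved with one additional vector, the sum \<open>u\<close> of the remaining unit vectors
  (\<open>realizes_few_ones\<close>).  This is where \<open>K > d\<close> enters: for \<open>K = d\<close> the equation \<open>F H\<^sup>T = I\<close> forces
  \<open>F\<^sup>T H = I\<close>, so that \<open>\<alpha>\<close> has only ones.  Both constructions work over every commutative ring in which \<open>m\<close> and \<open>d\<close> become
  equal, and are stated there.
\<close>

section \<open>Counting modulo two\<close>

lemma of_nat_bit_eq_iff: "of_nat m = (of_nat n :: bit) \<longleftrightarrow> [m = n] (mod 2)"
  unfolding Z2.bit_eq_iff even_of_nat cong_def by presburger

lemma of_nat_num_nonzero:
  assumes "\<alpha> \<in> carrier_vec K"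
  shows "of_nat (num_nonzero \<alpha>) = (\<Sum>i<K. \<alpha> $ i)"
proof -
  have "(\<Sum>i<K. \<alpha> $ i) = (\<Sum>i<K. of_bool (\<alpha> $ i \<noteq> 0))"
    by (intro sum.cong) auto
  also have "\<dots> = of_nat (card {i. i < K \<and> \<alpha> $ i \<noteq> 0})"
    by (simp add: sum_of_bool_eq Int_def)
  finally show ?thesis using assms by (auto simp: num_nonzero_def)
qed

section \<open>Duality as a matrix equation\<close>

text \<open>The frame operator \<open>y \<mapsto> \<Sum>\<^sub>j (y, h\<^sub>j) f\<^sub>j\<close> is multiplication by \<open>F H\<^sup>T\<close>; this is its coordinate form.\<close>

lemma frame_operator_index:
  fixes F H :: "'a :: comm_ring_1 vec list"
  assumes "set F \<subseteq> carrier_vec d" "set H \<subseteq> carrier_vec d" "length H = length F"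
    and "y \<in> carrier_vec d" "a < d"
  shows "finsum_vec TYPE('a) d (\<lambda>j. (y \<bullet> H ! j) \<cdot>\<^sub>v F ! j) {..<length F} $ a
       = (\<Sum>b<d. y $ b * (\<Sum>j<length F. F ! j $ a * H ! j $ b))"
proof -
  have F: "F ! j \<in> carrier_vec d" and H: "H ! j \<in> carrier_vec d" if "j < length F" for j
    using assms that by (auto simp: subset_iff)
  have "finsum_vec TYPE('a) d (\<lambda>j. (y \<bullet> H ! j) \<cdot>\<^sub>v F ! j) {..<length F} $ a
      = (\<Sum>j<length F. ((y \<bullet> H ! j) \<cdot>\<^sub>v F ! j) $ a)"
    using F assms(5) by (intro index_finsum_vec) auto
  also have "\<dots> = (\<Sum>j<length F. \<Sum>b<d. y $ b * (F ! j $ a * H ! j $ b))"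
  proof (intro sum.cong refl)
    fix j assume "j \<in> {..<length F}"
    then have "F ! j \<in> carrier_vec d" "H ! j \<in> carrier_vec d" using F H by auto
    then show "((y \<bullet> H ! j) \<cdot>\<^sub>v F ! j) $ a = (\<Sum>b<d. y $ b * (F ! j $ a * H ! j $ b))"
      using assms(5) by (simp add: scalar_prod_def sum_distrib_left lessThan_atLeast0 mult_ac)
  qed
  also have "\<dots> = (\<Sum>b<d. y $ b * (\<Sum>j<length F. F ! j $ a * H ! j $ b))"
    by (subst sum.swap) (simp add: sum_distrib_left)
  finally show ?thesis .
qed

text \<open>The family \<open>F\<close> may have repetitions, so the coefficients are indexed by positions in the list
  and not by vectors as in linear combinations over a set.\<close>

lemma span_eq_carrier_vecI:
  fixes F :: "'a :: field vec list"
  assumes F: "set F \<subseteq> carrier_vec d"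
    and rec: "\<And>y. y \<in> carrier_vec d \<Longrightarrow>
      \<exists>c. y = finsum_vec TYPE('a) d (\<lambda>j. c j \<cdot>\<^sub>v F ! j) {..<length F}"
  shows "LinearCombinations.module.span class_ring (module_vec TYPE('a) d) (set F) = carrier_vec d"
proof -
  interpret vec_space "TYPE('a)" d .
  have in_span: "finsum_vec TYPE('a) d (\<lambda>j. c j \<cdot>\<^sub>v F ! j) {..<n} \<in> span (set F)"
    if "n \<le> length F" for c n
    using that
  proof (induction n)
    case 0
    then show ?case using span_zero[of "set F"] by (simp add: finsum_vec_empty)
  next
    case (Suc n)
    then have *: "c n \<cdot>\<^sub>v F ! n \<in> span (set F)"
      using F by (intro smult_in_span in_own_span[THEN subsetD]) auto
    have "finsum_vec TYPE('a) d (\<lambda>j. c j \<cdot>\<^sub>v F ! j) {..<Suc n}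
        = c n \<cdot>\<^sub>v F ! n + finsum_vec TYPE('a) d (\<lambda>j. c j \<cdot>\<^sub>v F ! j) {..<n}"
      unfolding lessThan_Suc using F Suc.prems
      by (intro finsum_vec_insert) (auto simp: subset_iff)
    then show ?case using span_add1[OF _ *] Suc F by (auto simp del: finsum_vec)
  qed
  show ?thesis
  proof
    show "span (set F) \<subseteq> carrier_vec d" using F by (intro span_is_subset2)
    show "carrier_vec d \<subseteq> span (set F)" using rec in_span[OF order_refl] by (metis subsetI)
  qed
qed

text \<open>The reconstruction formula is linear in \<open>y\<close>, so it amounts to its instances at unit vectors;
  spanning then comes for free, because the formula exhibits each \<open>y\<close> as a combination of \<open>F\<close>.\<close>

lemma dual_frame_pair_iff:
  assumes F: "set F \<subseteq> carrier_vec d" and H: "set H \<subseteq> carrier_vec d" and len: "length H = length F"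
  shows "dual_frame_pair d F H \<longleftrightarrow>
    (\<forall>a<d. \<forall>b<d. (\<Sum>j<length F. F ! j $ a * H ! j $ b) = of_bool (a = b))" (is "_ \<longleftrightarrow> ?inv")
proof
  assume dual: "dual_frame_pair d F H"
  show ?inv
  proof (intro allI impI)
    fix a b assume ab: "a < d" "b < d"
    have "unit_vec d b = finsum_vec TYPE(bit) d (\<lambda>j. (unit_vec d b \<bullet> H ! j) \<cdot>\<^sub>v F ! j) {..<length F}"
      using dual by (simp add: dual_frame_pair_def)
    then have "unit_vec d b $ a = (\<Sum>c<d. unit_vec d b $ c * (\<Sum>j<length F. F ! j $ a * H ! j $ c))"
      using frame_operator_index[OF F H len unit_vec_carrier ab(1)] by metis
    also have "\<dots> = (\<Sum>c<d. if c = b then (\<Sum>j<length F. F ! j $ a * H ! j $ c) else 0)"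
      using ab by (intro sum.cong) auto
    also have "\<dots> = (\<Sum>j<length F. F ! j $ a * H ! j $ b)"
      using ab by simp
    finally show "(\<Sum>j<length F. F ! j $ a * H ! j $ b) = of_bool (a = b)"
      using ab by auto
  qed
next
  assume inv: ?inv
  have rec: "y = finsum_vec TYPE(bit) d (\<lambda>j. (y \<bullet> H ! j) \<cdot>\<^sub>v F ! j) {..<length F}"
    (is "_ = ?s") if y: "y \<in> carrier_vec d" for y
  proof (rule eq_vecI)
    have "F ! j \<in> carrier_vec d" if "j < length F" for j using F that by (auto simp: subset_iff)
    then have "?s \<in> carrier_vec d" by (intro finsum_vec_closed) auto
    then show dim: "dim_vec y = dim_vec ?s" using y by auto
    fix a assume "a < dim_vec ?s"
    then have a: "a < d" using dim y by auto
    have "?s $ a = (\<Sum>b<d. y $ b * (\<Sum>j<length F. F ! j $ a * H ! j $ b))"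
      using frame_operator_index[OF F H len y a] .
    also have "\<dots> = (\<Sum>b<d. if b = a then y $ b else 0)"
      using inv a by (intro sum.cong) auto
    also have "\<dots> = y $ a" using a by simp
    finally show "y $ a = ?s $ a" by simp
  qed
  have "binary_frame d F"
    unfolding binary_frame_def using F rec by (intro conjI span_eq_carrier_vecI exI) auto
  then show "dual_frame_pair d F H"
    using rec H len by (simp add: dual_frame_pair_def)
qed

section \<open>The trace obstruction and the permutation symmetry\<close>

text \<open>
  Here \<open>f\<close> and \<open>h\<close> are \<open>K\<close> vectors given by their coordinate functions, and the two conjuncts
  are \<open>F H\<^sup>T = I\<close> and \<open>diag (F\<^sup>T H) = \<alpha>\<close>.  Functions on all of \<^typ>\<open>nat\<close> make permuting the vectors a mere
  composition.
\<close>

definition realizes :: "nat \<Rightarrow> nat \<Rightarrow> (nat \<Rightarrow> 'a :: comm_ring_1) \<Rightarrow> (nat \<Rightarrow> nat \<Rightarrow> 'a) \<Rightarrow>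
    (nat \<Rightarrow> nat \<Rightarrow> 'a) \<Rightarrow> bool" where
  "realizes d K \<alpha> f h \<longleftrightarrow>
     (\<forall>a<d. \<forall>b<d. (\<Sum>j<K. f j a * h j b) = of_bool (a = b)) \<and>
     (\<forall>j<K. (\<Sum>a<d. f j a * h j a) = \<alpha> j)"

lemma dual_frame_pair_ex_iff_realizes:
  "(\<exists>F H. dual_frame_pair d F H \<and> length F = K \<and> length H = K \<and> (\<forall>i<K. F ! i \<bullet> H ! i = \<alpha> i))
   \<longleftrightarrow> (\<exists>f h. realizes d K \<alpha> f h)"
proof
  assume "\<exists>F H. dual_frame_pair d F H \<and> length F = K \<and> length H = K \<and> (\<forall>i<K. F ! i \<bullet> H ! i = \<alpha> i)"
  then obtain F H where dual: "dual_frame_pair d F H" and len: "length F = K" "length H = K"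
    and diag: "\<forall>i<K. F ! i \<bullet> H ! i = \<alpha> i" by blast
  have FH: "set F \<subseteq> carrier_vec d" "set H \<subseteq> carrier_vec d"
    using dual by (auto simp: dual_frame_pair_def binary_frame_def)
  have "F ! j \<bullet> H ! j = (\<Sum>a<d. F ! j $ a * H ! j $ a)" if "j < K" for j
  proof -
    have "H ! j \<in> carrier_vec d" using FH len that by (auto simp: subset_iff)
    then show ?thesis by (simp add: scalar_prod_def lessThan_atLeast0)
  qed
  then have "realizes d K \<alpha> (\<lambda>j. vec_index (F ! j)) (\<lambda>j. vec_index (H ! j))"
    using dual diag len dual_frame_pair_iff[OF FH] by (simp add: realizes_def)
  then show "\<exists>f h. realizes d K \<alpha> f h" by blast
next
  assume "\<exists>f h. realizes d K \<alpha> f h"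
  then obtain f h where fh: "realizes d K \<alpha> f h" by blast
  let ?F = "map (\<lambda>j. vec d (f j)) [0..<K]" and ?H = "map (\<lambda>j. vec d (h j)) [0..<K]"
  have "dual_frame_pair d ?F ?H"
    using fh by (subst dual_frame_pair_iff) (auto simp: realizes_def)
  moreover have "?F ! i \<bullet> ?H ! i = \<alpha> i" if "i < K" for i
    using fh that by (simp add: realizes_def scalar_prod_def lessThan_atLeast0)
  ultimately show "\<exists>F H. dual_frame_pair d F H \<and> length F = K \<and> length H = K \<and>
      (\<forall>i<K. F ! i \<bullet> H ! i = \<alpha> i)"
    by (intro exI[of _ ?F] exI[of _ ?H]) simp
qed

text \<open>The trace of \<open>F\<^sup>T H\<close> equals that of \<open>F H\<^sup>T = I\<close>.\<close>

lemma realizes_trace: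
  assumes "realizes d K \<alpha> f h"
  shows "(\<Sum>j<K. \<alpha> j) = of_nat d"
proof -
  have "(\<Sum>j<K. \<alpha> j) = (\<Sum>j<K. \<Sum>a<d. f j a * h j a)"
    using assms by (simp add: realizes_def)
  also have "\<dots> = (\<Sum>a<d. \<Sum>j<K. f j a * h j a)" by (rule sum.swap)
  also have "\<dots> = (\<Sum>a<d. 1)" using assms by (simp add: realizes_def)
  finally show ?thesis by simp
qed

lemma realizes_permute:
  assumes "realizes d K \<alpha> f h" and p: "bij_betw p {..<K} {..<K}"
  shows "realizes d K (\<lambda>j. \<alpha> (p j)) (\<lambda>j. f (p j)) (\<lambda>j. h (p j))"
proof -
  have "(\<Sum>j<K. f (p j) a * h (p j) b) = (\<Sum>j<K. f j a * h j b)" for a b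
    by (rule sum.reindex_bij_betw[OF p])
  moreover have "p j < K" if "j < K" for j
    using p that by (auto dest: bij_betwE)
  ultimately show ?thesis using assms(1) by (simp add: realizes_def)
qed

lemma bij_betw_sorting_subset:
  assumes "S \<subseteq> {..<K :: nat}"
  obtains p where "bij_betw p {..<K} {..<K}" "\<And>j. j < K \<Longrightarrow> p j < card S \<longleftrightarrow> j \<in> S"
proof -
  have fin: "finite S" using assms finite_subset by blast
  have le: "card S \<le> K" using card_mono[OF _ assms] by simp
  obtain g where g: "bij_betw g S {..<card S}"
    using finite_same_card_bij[of S "{..<card S}"] fin by auto
  obtain g' where g': "bij_betw g' ({..<K} - S) {card S..<K}"
    using finite_same_card_bij[of "{..<K} - S" "{card S..<K}"] fin assms
    by (auto simp: card_Diff_subset)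
  define p where "p j = (if j \<in> S then g j else g' j)" for j
  have p: "bij_betw p S {..<card S}" "bij_betw p ({..<K} - S) {card S..<K}"
    using g g'
    by (auto simp: p_def intro: bij_betw_cong[THEN iffD1, rotated])
  have "bij_betw p (S \<union> ({..<K} - S)) ({..<card S} \<union> {card S..<K})"
    using p by (rule bij_betw_combine) auto
  moreover have "S \<union> ({..<K} - S) = {..<K}" "{..<card S} \<union> {card S..<K} = {..<K}"
    using assms le by auto
  ultimately have "bij_betw p {..<K} {..<K}" by simp
  moreover have "p j < card S \<longleftrightarrow> j \<in> S" if "j < K" for j
    using bij_betwE[OF p(1)] bspec[OF bij_betwE[OF p(2)], of j] that
    by (cases "j \<in> S") auto
  ultimately show ?thesis using that by blast
qed

section \<open>Constructions for sorted diagonals\<close>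

text \<open>Unit vectors \<open>e\<^sub>0, \<dots>, e\<^sub>d\<^sub>-\<^sub>2\<close> occur once and \<open>e\<^sub>d\<^sub>-\<^sub>1\<close> occurs \<open>m - d + 1\<close> times, a number
  that the hypothesis turns into \<open>1\<close> in the ring.\<close>

lemma realizes_many_ones:
  assumes "d \<ge> 1" "d \<le> m" "m \<le> K" and ring_eq: "of_nat m = (of_nat d :: 'a :: comm_ring_1)"
  defines "f \<equiv> \<lambda>j a. of_bool (j < m \<and> a = min j (d - 1)) :: 'a"
  shows "realizes d K (\<lambda>j. of_bool (j < m)) f f"
proof -
  have "(\<Sum>j<K. f j a * f j b) = of_bool (a = b)" if "a < d" "b < d" for a b
  proof (cases "a = b")
    case False
    then show ?thesis by (auto simp: f_def intro!: sum.neutral)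
  next
    case [simp]: True
    have "(\<Sum>j<K. f j a * f j b) = (\<Sum>j<K. of_bool (j < m \<and> a = min j (d - 1)))"
      by (intro sum.cong) (auto simp: f_def)
    also have "\<dots> = of_nat (card {j. j < K \<and> j < m \<and> a = min j (d - 1)})"
      by (simp add: sum_of_bool_eq Int_def)
    also have "{j. j < K \<and> j < m \<and> a = min j (d - 1)} = (if a < d - 1 then {a} else {d - 1..<m})"
      using assms that by auto
    also have "of_nat (card \<dots>) = (1 :: 'a)"
    proof -
      have "of_nat (m - (d - 1)) = (of_nat m - of_nat (d - 1) :: 'a)"
        using assms by (simp add: of_nat_diff)
      also have "\<dots> = 1" using assms(1) ring_eq by (simp add: of_nat_diff)
      finally show ?thesis by simp
    qed
    finally show ?thesis by simp
  qed
  moreover have "(\<Sum>a<d. f j a * f j a) = of_bool (j < m)" if "j < K" for j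
  proof -
    have "(\<Sum>a<d. f j a * f j a) = (\<Sum>a<d. if a = min j (d - 1) then of_bool (j < m) else 0)"
      by (intro sum.cong) (auto simp: f_def)
    then show ?thesis using assms(1) by auto
  qed
  ultimately show ?thesis by (simp add: realizes_def)
qed

text \<open>
  With \<open>u = e\<^sub>m + \<dots> + e\<^sub>d\<^sub>-\<^sub>1\<close>, the pairs are \<open>(e\<^sub>j, e\<^sub>j)\<close> for \<open>j < m\<close>, \<open>(e\<^sub>j, e\<^sub>j - u)\<close> for \<open>m \<le> j < d\<close>,
  and \<open>(u, u)\<close> for \<open>j = d\<close>.  The correction by \<open>- u\<close> kills the diagonal entries from \<open>m\<close> to \<open>d - 1\<close> and
  contributes \<open>- u u\<^sup>T\<close> to \<open>F H\<^sup>T\<close>; the additional pair restores this term and has diagonal entry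
  \<open>d - m\<close>, which is zero in the ring.
\<close>

lemma realizes_few_ones:
  assumes "m < d" "d < K" and ring_eq: "of_nat m = (of_nat d :: 'a :: comm_ring_1)"
  defines "f \<equiv> \<lambda>j a. if j < d then of_bool (a = j) else of_bool (j = d \<and> m \<le> a) :: 'a"
    and "h \<equiv> \<lambda>j a. if j < d then of_bool (a = j) - of_bool (m \<le> j \<and> m \<le> a)
      else of_bool (j = d \<and> m \<le> a) :: 'a"
  shows "realizes d K (\<lambda>j. of_bool (j < m)) f h"
proof -
  have "(\<Sum>j<K. f j a * h j b) = of_bool (a = b)" if ab: "a < d" "b < d" for a b
  proof -
    \<comment> \<open>Positions after \<open>d\<close> carry zero vectors, and position \<open>d\<close> carries the pair \<open>(u, u)\<close>.\<close>
    have "(\<Sum>j<K. f j a * h j b) = (\<Sum>j<Suc d. f j a * h j b)"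
      using assms(2) by (intro sum.mono_neutral_right) (auto simp: f_def)
    also have "\<dots> = (\<Sum>j<d. if j = a then h a b else 0) + h d b * of_bool (m \<le> a)"
      unfolding sum.lessThan_Suc
      by (intro arg_cong2[where f = "(+)"] sum.cong) (auto simp: f_def)
    also have "\<dots> = h a b + h d b * of_bool (m \<le> a)" using ab by simp
    also have "\<dots> = of_bool (a = b)" using ab assms(1) by (auto simp: h_def)
    finally show ?thesis .
  qed
  moreover have "(\<Sum>a<d. f j a * h j a) = of_bool (j < m)" if "j < K" for j
  proof -
    consider "j < d" | "j = d" | "j > d" by linarith
    then show ?thesis
    proof cases
      case 1
      then have "(\<Sum>a<d. f j a * h j a) = (\<Sum>a<d. if a = j then h j j else 0)"
        by (intro sum.cong) (auto simp: f_def)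
      also have "\<dots> = h j j" using 1 by simp
      also have "\<dots> = of_bool (j < m)" using 1 by (auto simp: h_def)
      finally show ?thesis .
    next
      case 2
      have "(\<Sum>a<d. f j a * h j a) = (\<Sum>a<d. of_bool (m \<le> a))"
        using 2 assms(1) by (intro sum.cong) (auto simp: f_def h_def)
      also have "\<dots> = of_nat (card {a. a < d \<and> m \<le> a})"
        by (simp add: sum_of_bool_eq Int_def)
      also have "{a. a < d \<and> m \<le> a} = {m..<d}" by auto
      also have "of_nat (card {m..<d}) = (0 :: 'a)"
        using assms(1) ring_eq by (simp add: of_nat_diff)
      finally show ?thesis using 2 assms(1) by simp
    next
      case 3
      then show ?thesis using assms(1) by (simp add: f_def)
    qed
  qed
  ultimately show ?thesis by (simp add: realizes_def)
qed

section \<open>The characterization of the diagonals\<close>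

theorem theorem3p2:
  fixes d K :: nat and \<alpha> :: "bit vec"
  assumes "d \<ge> 1" and "K > d" and "\<alpha> \<in> carrier_vec K"
  shows "(\<exists>F H. dual_frame_pair d F H \<and> length F = K \<and> length H = K \<and>
            (\<forall>i<K. F ! i \<bullet> H ! i = \<alpha> $ i))
         \<longleftrightarrow> [num_nonzero \<alpha> = d] (mod 2)"
  unfolding dual_frame_pair_ex_iff_realizes[where \<alpha> = "vec_index \<alpha>"] of_nat_bit_eq_iff[symmetric]
proof
  assume "\<exists>f h. realizes d K (vec_index \<alpha>) f h"
  then show "of_nat (num_nonzero \<alpha>) = (of_nat d :: bit)"
    using realizes_trace of_nat_num_nonzero[OF assms(3)] by metis
next
  assume parity: "of_nat (num_nonzero \<alpha>) = (of_nat d :: bit)"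
  define S where "S = {i. i < K \<and> \<alpha> $ i \<noteq> 0}"
  define m where "m = card S"
  have S: "S \<subseteq> {..<K}" by (auto simp: S_def)
  have m: "of_nat m = (of_nat d :: bit)"
    using parity assms(3) by (auto simp: m_def S_def num_nonzero_def)
  have "m \<le> K" using card_mono[OF _ S] by (simp add: m_def)
  obtain f h :: "nat \<Rightarrow> nat \<Rightarrow> bit" where fh: "realizes d K (\<lambda>j. of_bool (j < m)) f h"
  proof (cases "m < d")
    case True
    then show ?thesis using realizes_few_ones[OF _ assms(2) m] that by blast
  next
    case False
    then show ?thesis using realizes_many_ones[OF assms(1) _ \<open>m \<le> K\<close> m] that by auto
  qed
  obtain p where p: "bij_betw p {..<K} {..<K}" "\<And>j. j < K \<Longrightarrow> p j < card S \<longleftrightarrow> j \<in> S"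
    using bij_betw_sorting_subset[OF S] by blast
  have "of_bool (p j < m) = \<alpha> $ j" if "j < K" for j
    using p(2)[OF that] that by (auto simp: m_def S_def)
  then have "realizes d K (vec_index \<alpha>) (\<lambda>j. f (p j)) (\<lambda>j. h (p j))"
    using realizes_permute[OF fh p(1)] by (simp add: realizes_def)
  then show "\<exists>f h. realizes d K (vec_index \<alpha>) f h" by blast
qed

end
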